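(* Let $\alpha\in(1,\infty)$ and $\Psi(n)=2^{-n\alpha}$. Then $\mathcal{H}^{1/\alpha}(W_{\sqrt{2}}(\Psi))=\infty$.
   Context: For $\beta\in(1,2)$ and $\Psi:\mathbb{N}\to\mathbb{R}_{\geq0}$, $$W_{\beta}(\Psi):=\bigcap_{m=1}^{\infty}\bigcup_{n=m}^{\infty}\bigcup_{(\epsilon_{i})_{i=1}^{n}\in\{0,1\}^{n}}\Big[\sum_{i=1}^{n}\frac{\epsilon_{i}}{\beta^{i}},\sum_{i=1}^{n}\frac{\epsilon_{i}}{\beta^{i}}+\Psi(n)\Big].$$ $\mathcal{H}^s$ denotes $s$-dimensional Hausdorff measure. *)

theory Defs
  imports "HOL-Analysis.Analysis"
begin

text \<open>The s-th power of the diameter, with the usual conventions of geometric measure theory that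
  the empty set contributes 0 and that \<open>0\<^sup>0 = 1\<close> (whereas \<open>0 powr 0 = 0\<close>).
  Only meaningful for bounded sets, since \<open>diameter\<close> is real-valued.\<close>

definition diam_pow :: "real \<Rightarrow> 'a::metric_space set \<Rightarrow> ennreal" where
  "diam_pow s U =
     (if U = {} then 0 else if s = 0 then 1 else ennreal (diameter U powr s))"

text \<open>Finite covers are included, since cover members may be empty. If there is no admissible
  cover, the infimum is \<open>\<infinity>\<close>.\<close>

definition hausdorff_premeasure :: "real \<Rightarrow> real \<Rightarrow> 'a::metric_space set \<Rightarrow> ennreal" where
  "hausdorff_premeasure s \<delta> A =
     (INF U \<in> {U :: nat \<Rightarrow> 'a set. A \<subseteq> (\<Union>i. U i) \<and> (\<forall>i. bounded (U i) \<and> diameter (U i) \<le> \<delta>)}.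
        \<Sum>i. diam_pow s (U i))"

text \<open>Hausdorff (outer) measure, without a dimensional normalising constant.\<close>

definition hausdorff_measure :: "real \<Rightarrow> 'a::metric_space set \<Rightarrow> ennreal" where
  "hausdorff_measure s A = (SUP \<delta>\<in>{0<..}. hausdorff_premeasure s \<delta> A)"

text \<open>The words of length n are represented by functions on \<open>{1..n}\<close>. Since \<open>m \<ge> 1\<close>, the value of
  \<open>\<Psi>\<close> at 0 is irrelevant.\<close>

definition W :: "real \<Rightarrow> (nat \<Rightarrow> real) \<Rightarrow> real set" where
  "W \<beta> \<Psi> =
     (\<Inter>m\<in>{1..}. \<Union>n\<in>{m..}. \<Union>\<epsilon> \<in> {1..n} \<rightarrow>\<^sub>E {0, 1}.
        {(\<Sum>i=1..n. \<epsilon> i / \<beta> ^ i) .. (\<Sum>i=1..n. \<epsilon> i / \<beta> ^ i) + \<Psi> n})"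

end

(* The sums of even length 2k are the numbers (a + b sqrt 2) / 2^k with 0 <= a, b < 2^k. As sqrt 2 is
   badly approximable, these 4^k points are separated by a constant times 4^(-k), and every
   interval I in [1/2, 1] contains at least a constant times |I| 4^k of them once k is large.

   Write s = 1/alpha, and suppose that a cover (U_i) has finite s-cost and that the diameters of
   those U_i that meet I have sum at most c |I|. Then for large k some interval J in I of level 2k
   satisfies the same bound: otherwise each J of this level that meets no large U_i has s-cost at
   least (c |J|)^s = c^s 4^(-k), which sums to a multiple of |I|, although only the small U_i,
   whose total s-cost tends to 0, contribute. Iterating gives nested intervals whose common point
   lies in W and in no U_i. Any cover of finite s-cost with small enough mesh satisfies the
   initial bound on [1/2, 1] because s < 1, so there is none. *)

theory Submission
  imports Defs
begin

section \<open>Bad approximability of the square root of 2\<close>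

text \<open>Infinite descent: a solution with \<open>b \<noteq> 0\<close> has
  \<open>a = 2 * c\<close>, and then \<open>(b, c)\<close> solves the same equation with
  \<open>c < b\<close>.\<close>

lemma square_eq_double_square:
  fixes a b :: nat
  assumes "a\<^sup>2 = 2 * b\<^sup>2"
  shows "b = 0"
  using assms
proof (induction b arbitrary: a rule: less_induct)
  case (less b)
  show ?case
  proof (rule ccontr)
    assume "b \<noteq> 0"
    have "even (a\<^sup>2)" using less.prems by simp
    then obtain c where c: "a = 2 * c" by (auto elim: evenE)
    have b: "b\<^sup>2 = 2 * c\<^sup>2" using less.prems unfolding c by (simp add: power2_eq_square)
    have "c < b"
    proof (rule ccontr)
      assume "\<not> c < b"
      hence "b\<^sup>2 \<le> c\<^sup>2" by (intro power_mono) auto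
      moreover have "0 < b\<^sup>2" using \<open>b \<noteq> 0\<close> by simp
      ultimately show False using b by linarith
    qed
    from less.IH[OF this b] b \<open>b \<noteq> 0\<close> less.prems show False
      by (metis power_zero_numeral mult_0_right power2_eq_square mult_is_0)
  qed
qed

text \<open>The norm \<open>A\<^sup>2 - 2 * B\<^sup>2\<close> is a nonzero integer, so its absolute
  value is at least 1. It is the product of \<open>A + B * sqrt 2\<close> and its conjugate, and the
  conjugate is at most \<open>3 * N\<close> in absolute value.\<close>

lemma sqrt2_badly_approximable:
  fixes A B :: int and N :: real
  assumes "A \<noteq> 0 \<or> B \<noteq> 0" "\<bar>A\<bar> \<le> N" "\<bar>B\<bar> \<le> N"
  shows "1 \<le> 3 * N * \<bar>A + B * sqrt 2\<bar>"
proof -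
  have ne: "A\<^sup>2 \<noteq> 2 * B\<^sup>2"
  proof
    assume eq: "A\<^sup>2 = 2 * B\<^sup>2"
    hence "int ((nat \<bar>A\<bar>)\<^sup>2) = int (2 * (nat \<bar>B\<bar>)\<^sup>2)" by simp
    hence "(nat \<bar>A\<bar>)\<^sup>2 = 2 * (nat \<bar>B\<bar>)\<^sup>2" by (simp only: of_nat_eq_iff)
    hence "nat \<bar>B\<bar> = 0" by (rule square_eq_double_square)
    hence "B = 0" by simp
    with eq assms(1) show False by simp
  qed
  have s2: "sqrt 2 \<le> 2" using real_sqrt_le_mono[of 2 4] by simp
  have "1 \<le> \<bar>A\<^sup>2 - 2 * B\<^sup>2\<bar>" using ne by linarith
  hence "1 \<le> \<bar>real_of_int (A\<^sup>2 - 2 * B\<^sup>2)\<bar>" by linarith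
  also have "real_of_int (A\<^sup>2 - 2 * B\<^sup>2) = (A - B * sqrt 2) * (A + B * sqrt 2)"
    by (simp add: algebra_simps power2_eq_square)
  also have "\<bar>\<dots>\<bar> = \<bar>A - B * sqrt 2\<bar> * \<bar>A + B * sqrt 2\<bar>" by (simp add: abs_mult)
  also have "\<dots> \<le> (3 * N) * \<bar>A + B * sqrt 2\<bar>"
  proof (rule mult_right_mono)
    have "\<bar>B * sqrt 2\<bar> \<le> N * 2"
      unfolding abs_mult using assms s2 by (intro mult_mono) auto
    thus "\<bar>A - B * sqrt 2\<bar> \<le> 3 * N" using assms by linarith
  qed simp
  finally show ?thesis .
qed

section \<open>Finite expansions in base \<open>sqrt 2\<close>\<close>

definition beta_sums :: "real \<Rightarrow> nat \<Rightarrow> real set" where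
  "beta_sums \<beta> n = (\<lambda>\<epsilon>. \<Sum>i=1..n. \<epsilon> i / \<beta> ^ i) ` ({1..n} \<rightarrow>\<^sub>E {0, 1})"

lemma W_eq: "W \<beta> \<Psi> = (\<Inter>m\<in>{1..}. \<Union>n\<in>{m..}. \<Union>p\<in>beta_sums \<beta> n. {p..p + \<Psi> n})"
  unfolding W_def beta_sums_def by (simp add: image_image)

lemma beta_sums_Suc:
  assumes "p \<in> beta_sums \<beta> n" "e \<in> {0, 1}"
  shows "p + e / \<beta> ^ Suc n \<in> beta_sums \<beta> (Suc n)"
proof -
  from assms(1) obtain \<epsilon> where \<epsilon>: "\<epsilon> \<in> {1..n} \<rightarrow>\<^sub>E {0, 1}" "p = (\<Sum>i=1..n. \<epsilon> i / \<beta> ^ i)"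
    unfolding beta_sums_def by auto
  define \<epsilon>' where "\<epsilon>' = \<epsilon>(Suc n := e)"
  have ins: "{1..Suc n} = insert (Suc n) {1..n}" by auto
  have "\<epsilon>' \<in> {1..Suc n} \<rightarrow>\<^sub>E {0, 1}"
    unfolding \<epsilon>'_def ins using \<epsilon>(1) assms(2) by (intro PiE_fun_upd)
  moreover have "(\<Sum>i=1..Suc n. \<epsilon>' i / \<beta> ^ i) = p + e / \<beta> ^ Suc n"
  proof -
    have "(\<Sum>i=1..n. \<epsilon>' i / \<beta> ^ i) = p"
      unfolding \<epsilon>(2) \<epsilon>'_def by (intro sum.cong) auto
    thus ?thesis by (simp add: \<epsilon>'_def)
  qed
  ultimately show ?thesis unfolding beta_sums_def by (intro rev_image_eqI) auto
qed

text \<open>Even-indexed digits contribute a dyadic rational, odd-indexed ones \<open>sqrt 2\<close> times a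
  dyadic rational.\<close>

lemma beta_sums_sqrt2:
  assumes "a < 2 ^ k" "b < 2 ^ k"
  shows "(real a + real b * sqrt 2) / 2 ^ k \<in> beta_sums (sqrt 2) (2 * k)"
  using assms
proof (induction k arbitrary: a b)
  case 0
  thus ?case by (auto simp: beta_sums_def)
next
  case (Suc k)
  have pw: "sqrt 2 ^ (2 * k) = 2 ^ k" by (simp add: power_mult)
  \<comment> \<open>The lowest binary digits of \<open>b\<close> and \<open>a\<close> become the new
    digits at positions \<open>2 * k + 1\<close> and \<open>2 * k + 2\<close>.\<close>
  let ?a = "a mod 2" and ?b = "b mod 2"
  have "a div 2 < 2 ^ k" "b div 2 < 2 ^ k" using Suc.prems by auto
  from Suc.IH[OF this]
  have "(real (a div 2) + real (b div 2) * sqrt 2) / 2 ^ k \<in> beta_sums (sqrt 2) (2 * k)" .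
  hence "(real (a div 2) + real (b div 2) * sqrt 2) / 2 ^ k + real ?b / sqrt 2 ^ Suc (2 * k)
      + real ?a / sqrt 2 ^ Suc (Suc (2 * k)) \<in> beta_sums (sqrt 2) (Suc (Suc (2 * k)))"
    by (intro beta_sums_Suc) (auto simp: of_nat_eq_iff)
  moreover have "(real (a div 2) + real (b div 2) * sqrt 2) / 2 ^ k
      + real ?b / sqrt 2 ^ Suc (2 * k) + real ?a / sqrt 2 ^ Suc (Suc (2 * k))
    = (real (2 * (a div 2) + ?a) + real (2 * (b div 2) + ?b) * sqrt 2) / 2 ^ Suc k"
  proof -
    have "sqrt 2 ^ Suc (2 * k) = sqrt 2 * 2 ^ k" "sqrt 2 ^ Suc (Suc (2 * k)) = 2 * 2 ^ k"
      using pw by simp_all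
    moreover have "real ?b / (sqrt 2 * 2 ^ k) = real ?b * sqrt 2 / (2 * 2 ^ k)"
      by (simp add: divide_simps)
    moreover have "(x + y * sqrt 2) / N + f * sqrt 2 / (2 * N) + e / (2 * N)
        = (2 * x + e + (2 * y + f) * sqrt 2) / (2 * N)" if "0 < N" for x y e f N :: real
      using that by (simp add: field_simps)
    ultimately show ?thesis by (simp only: of_nat_add of_nat_mult of_nat_numeral power_Suc) simp
  qed
  ultimately show ?case by simp
qed

text \<open>With \<open>N = 2 ^ k\<close>, each \<open>b < N / 4\<close> admits a run of at least
  \<open>N * (v - u) / 4\<close> integers \<open>a\<close> that put
  \<open>(a + b * sqrt 2) / N\<close> into the left half of \<open>[u, v]\<close>. Bad
  approximability separates these points. The right half stays free for the intervals that will
  start at them.\<close>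

lemma many_separated_beta_sums:
  fixes u v :: real
  assumes uv: "1/2 \<le> u" "v \<le> 1" "u < v" and k: "2 \<le> k" "4 \<le> 2 ^ k * (v - u)"
  shows "\<exists>S. finite S \<and> S \<subseteq> beta_sums (sqrt 2) (2 * k) \<and> S \<subseteq> {u..(u + v) / 2} \<and>
    (\<forall>p\<in>S. \<forall>q\<in>S. p \<noteq> q \<longrightarrow> 1 / (3 * 4 ^ k) \<le> \<bar>p - q\<bar>) \<and>
    4 ^ k * (v - u) / 16 \<le> real (card S)"
proof -
  define N :: nat where "N = 2 ^ k"
  have N: "real N = 2 ^ k" "0 < N" unfolding N_def by auto
  have NN: "real N * real N = 4 ^ k" by (simp add: N power_mult_distrib[symmetric])
  have N4: "N = 4 * 2 ^ (k - 2)"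
    using le_Suc_ex[OF k(1)] by (auto simp: N_def)
  define T where "T = nat \<lfloor>real N * (v - u) / 2\<rfloor>"
  have pos: "0 < real N * (v - u)" using N uv by simp
  have T1: "real T \<le> real N * (v - u) / 2" unfolding T_def using pos by linarith
  \<comment> \<open>The number rounded down in \<open>T\<close> is at least 2, so rounding loses at
    most half of it.\<close>
  have "4 \<le> real N * (v - u)" using k(2) N(1) by simp
  hence T2: "real N * (v - u) / 4 \<le> real T" unfolding T_def by linarith
  \<comment> \<open>The first integer with \<open>a b + b * sqrt 2 \<ge> N * u\<close>.\<close>
  define a where "a b = nat \<lceil>real N * u - real b * sqrt 2\<rceil>" for b
  have s2: "sqrt 2 < 2" using real_sqrt_less_mono[of 2 4] by simp
  \<comment> \<open>Here \<open>1/2 \<le> u\<close> and \<open>b < N / 4\<close> enter: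
    \<open>nat\<close> truncates nothing in \<open>a b\<close>.\<close>
  have xpos: "0 \<le> real N * u - real b * sqrt 2" if "b < 2 ^ (k - 2)" for b
  proof -
    have "real b * sqrt 2 \<le> (real N / 4) * 2"
      using that N4 s2 by (intro mult_mono) auto
    also have "\<dots> \<le> real N * u" using uv(1) N by (simp add: field_simps)
    finally show ?thesis by simp
  qed
  have a1: "real N * u - real b * sqrt 2 \<le> real (a b)"
    and a2: "real (a b) < real N * u - real b * sqrt 2 + 1" if "b < 2 ^ (k - 2)" for b
    using xpos[OF that] unfolding a_def by linarith+
  define D :: "(nat \<times> nat) set" where "D = {..<2 ^ (k - 2)} \<times> {..<T}"
  define P where "P = (\<lambda>(b, t). (real (a b + t) + real b * sqrt 2) / 2 ^ k)"
  have bounds: "real N * u \<le> real (a b + t) + real b * sqrt 2"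
    "real (a b + t) + real b * sqrt 2 \<le> real N * ((u + v) / 2)"
    "a b + t < N" "b < N"
    if "b < 2 ^ (k - 2)" "t < T" for b t
  proof -
    \<comment> \<open>The strict bound \<open>t < T\<close> leaves the slack 1 that pays for
      rounding up in \<open>a b\<close>.\<close>
    have t: "real t + 1 \<le> real N * (v - u) / 2" using that T1 by linarith
    show "real N * u \<le> real (a b + t) + real b * sqrt 2" using a1[OF that(1)] by simp
    show le: "real (a b + t) + real b * sqrt 2 \<le> real N * ((u + v) / 2)"
      using a2[OF that(1)] t by (simp add: field_simps)
    have "real N * ((u + v) / 2) < real N * 1" using uv N by (intro mult_strict_left_mono) auto
    moreover have "0 \<le> real b * sqrt 2" by simp
    ultimately have "real (a b + t) < real N" using le by linarith
    thus "a b + t < N" by linarith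
    show "b < N" using that N4 by linarith
  qed
  have sep: "1 / (3 * 4 ^ k) \<le> \<bar>P x - P y\<bar>" if xy: "x \<in> D" "y \<in> D" "x \<noteq> y" for x y
  proof -
    obtain b t b' t' where [simp]: "x = (b, t)" "y = (b', t')" by (cases x, cases y)
    have bt: "b < 2 ^ (k - 2)" "t < T" "b' < 2 ^ (k - 2)" "t' < T" using xy by (auto simp: D_def)
    define A where "A = int (a b + t) - int (a b' + t')"
    define B where "B = int b - int b'"
    have "A \<noteq> 0 \<or> B \<noteq> 0" using xy(3) unfolding A_def B_def by auto
    moreover have "\<bar>A\<bar> \<le> real N" "\<bar>B\<bar> \<le> real N"
      using bounds(3,4)[OF bt(1,2)] bounds(3,4)[OF bt(3,4)] unfolding A_def B_def by linarith+
    ultimately have "1 \<le> 3 * real N * \<bar>A + B * sqrt 2\<bar>" by (rule sqrt2_badly_approximable)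
    moreover have "P x - P y = (A + B * sqrt 2) / real N"
      unfolding P_def A_def B_def N by (simp add: field_simps)
    hence "\<bar>A + B * sqrt 2\<bar> = real N * \<bar>P x - P y\<bar>" using N by (simp add: abs_mult)
    ultimately have "1 \<le> 3 * (real N * real N) * \<bar>P x - P y\<bar>" by (simp add: mult_ac)
    thus ?thesis unfolding NN by (simp add: field_simps)
  qed
  have "inj_on P D"
  proof (rule inj_onI, rule ccontr)
    fix x y assume *: "x \<in> D" "y \<in> D" "P x = P y" "x \<noteq> y"
    have "(0::real) < 1 / (3 * 4 ^ k)" by simp
    also note sep[OF *(1,2,4)]
    finally show False using *(3) by simp
  qed
  hence "card (P ` D) = 2 ^ (k - 2) * T" by (simp add: card_image D_def)
  hence "real (card (P ` D)) = real N / 4 * real T" using N4 by simp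
  moreover have "real N / 4 * (real N * (v - u) / 4) \<le> real N / 4 * real T"
    using T2 by (intro mult_left_mono) auto
  moreover have "real N / 4 * (real N * (v - u) / 4) = 4 ^ k * (v - u) / 16"
    unfolding NN[symmetric] by simp
  ultimately have card: "4 ^ k * (v - u) / 16 \<le> real (card (P ` D))" by linarith
  have "P ` D \<subseteq> beta_sums (sqrt 2) (2 * k)"
    unfolding P_def D_def using bounds(3,4) unfolding N_def
    by (auto intro!: beta_sums_sqrt2 simp del: of_nat_add)
  moreover have "P ` D \<subseteq> {u..(u + v) / 2}"
  proof
    fix z assume "z \<in> P ` D"
    then obtain b t where bt: "b < 2 ^ (k - 2)" "t < T"
      and z: "z = (real (a b + t) + real b * sqrt 2) / real N" by (auto simp: P_def D_def N)
    from bounds(1,2)[OF bt] show "z \<in> {u..(u + v) / 2}"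
      unfolding z using N(2) by (simp add: field_simps del: of_nat_add)
  qed
  moreover have "finite (P ` D)" by (simp add: D_def)
  ultimately show ?thesis using card sep by (intro exI[of _ "P ` D"]) blast
qed

section \<open>Counting separated points and comparing sums of powers\<close>

text \<open>Cut the line into cells of length \<open>g\<close> starting at the minimum of
  \<open>S\<close>: each cell holds at most one point, and only the cells 0 to
  \<open>\<lfloor>D / g\<rfloor>\<close> can be occupied.\<close>

lemma card_separated_le:
  fixes S :: "real set"
  assumes "finite S" "0 < g"
    and "\<And>p q. p \<in> S \<Longrightarrow> q \<in> S \<Longrightarrow> p \<noteq> q \<Longrightarrow> g \<le> \<bar>p - q\<bar>"
    and "\<And>p q. p \<in> S \<Longrightarrow> q \<in> S \<Longrightarrow> \<bar>p - q\<bar> \<le> D" and "0 \<le> D"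
  shows "real (card S) \<le> 1 + D / g"
proof (cases "S = {}")
  case True
  thus ?thesis using assms by simp
next
  case False
  define m where "m = Min S"
  have m: "m \<in> S" "\<And>p. p \<in> S \<Longrightarrow> m \<le> p" unfolding m_def using False assms(1) by auto
  define f where "f p = nat \<lfloor>(p - m) / g\<rfloor>" for p
  have "inj_on f S"
  proof (rule inj_onI, rule ccontr)
    fix p q assume pq: "p \<in> S" "q \<in> S" "f p = f q" "p \<noteq> q"
    have "0 \<le> (p - m) / g" "0 \<le> (q - m) / g" using m pq assms(2) by auto
    hence "\<lfloor>(p - m) / g\<rfloor> = \<lfloor>(q - m) / g\<rfloor>" using pq(3) unfolding f_def
      by (metis zero_le_floor eq_nat_nat_iff)
    hence "\<bar>(p - m) / g - (q - m) / g\<bar> < 1" by linarith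
    moreover have "(p - m) / g - (q - m) / g = (p - q) / g" by (simp add: diff_divide_distrib)
    ultimately have "\<bar>p - q\<bar> < g" using assms(2) by (simp add: field_simps)
    with assms(3) pq show False by force
  qed
  moreover have "f ` S \<subseteq> {..nat \<lfloor>D / g\<rfloor>}"
  proof
    fix j assume "j \<in> f ` S"
    then obtain p where p: "p \<in> S" "j = f p" by auto
    have "p - m \<le> D" using assms(4)[OF p(1) m(1)] by simp
    hence "(p - m) / g \<le> D / g" using assms(2) by (simp add: divide_right_mono)
    thus "j \<in> {..nat \<lfloor>D / g\<rfloor>}" unfolding p(2) f_def by (simp add: nat_mono floor_mono)
  qed
  ultimately have "card S \<le> card {..nat \<lfloor>D / g\<rfloor>}" by (intro card_inj_on_le) auto
  hence "real (card S) \<le> 1 + real (nat \<lfloor>D / g\<rfloor>)" by simp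
  moreover have "0 \<le> D / g" using assms by simp
  hence "real (nat \<lfloor>D / g\<rfloor>) \<le> D / g" by linarith
  ultimately show ?thesis by linarith
qed

text \<open>The bound on the sum of powers forces \<open>d i \<le> D\<close> for each
  \<open>i\<close> in \<open>H\<close>, hence \<open>d i \<le> D powr (1 - s) * d i powr s\<close>,
  and these add up. Read in contraposition, a large sum of diameters forces a large
  \<open>s\<close>-cost.\<close>

lemma infsum_le_of_infsum_powr_le:
  fixes d :: "nat \<Rightarrow> real"
  assumes s: "0 < s" "s < 1" and d: "\<And>i. 0 < d i"
    and sd: "d summable_on H" and sds: "(\<lambda>i. d i powr s) summable_on H"
    and D: "0 < D" "(\<Sum>\<^sub>\<infinity>i\<in>H. d i powr s) \<le> D powr s"
  shows "infsum d H \<le> D"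
proof -
  have le: "d i \<le> D powr (1 - s) * d i powr s" if "i \<in> H" for i
  proof -
    have "d i powr s = sum (\<lambda>i. d i powr s) {i}" by simp
    also have "\<dots> \<le> (\<Sum>\<^sub>\<infinity>i\<in>H. d i powr s)"
      using that sds by (intro finite_sum_le_infsum) auto
    finally have "d i powr s \<le> D powr s" using D by linarith
    hence "d i \<le> D" using s d[of i] D by (metis powr_less_mono2 not_le less_imp_le)
    hence "d i powr (1 - s) \<le> D powr (1 - s)" using s d[of i] by (intro powr_mono2) auto
    hence "d i powr (1 - s) * d i powr s \<le> D powr (1 - s) * d i powr s"
      by (intro mult_right_mono) auto
    thus ?thesis using d[of i] by (simp add: powr_add[symmetric])
  qed
  have "infsum d H \<le> (\<Sum>\<^sub>\<infinity>i\<in>H. D powr (1 - s) * d i powr s)"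
    using le sd sds by (intro infsum_mono summable_on_cmult_right)
  also have "\<dots> = D powr (1 - s) * (\<Sum>\<^sub>\<infinity>i\<in>H. d i powr s)" by (rule infsum_cmult_right')
  also have "\<dots> \<le> D powr (1 - s) * D powr s" using D by (intro mult_left_mono) auto
  also have "\<dots> = D" using D by (simp add: powr_add[symmetric])
  finally show ?thesis .
qed

section \<open>Choice of a subinterval\<close>

text \<open>In the application \<open>K = 4 ^ k\<close> and \<open>r\<close> is the interval length
  at level \<open>2 * k\<close>. The constant is \<open>384 = 12 * 32\<close>: large members hit at
  most \<open>12 * K * (v - u) / 384 = K * (v - u) / 32\<close> of the intervals, half of the lower
  bound for \<open>card S\<close>. If all remaining intervals were bad, their costs would exceed
  \<open>tail\<close>.\<close>

lemma exists_good_subinterval: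
  fixes U :: "nat \<Rightarrow> real set" and d :: "nat \<Rightarrow> real" and K r s u v :: real
  assumes s: "0 < s" "s < 1" and d: "\<And>i. 0 < d i"
    and diam: "\<And>i x y. x \<in> U i \<Longrightarrow> y \<in> U i \<Longrightarrow> \<bar>x - y\<bar> \<le> d i"
    and sd: "d summable_on UNIV" and sds: "(\<lambda>i. d i powr s) summable_on UNIV"
    and K: "0 < K" and r: "0 < r" "r \<le> 1 / (6 * K)" "r powr s = 1 / K" and uv: "u < v"
    and S: "finite S" "\<And>p. p \<in> S \<Longrightarrow> {p..p + r} \<subseteq> {u..v}"
      "\<And>p q. p \<in> S \<Longrightarrow> q \<in> S \<Longrightarrow> p \<noteq> q \<Longrightarrow> 1 / (3 * K) \<le> \<bar>p - q\<bar>"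
      "K * (v - u) / 16 \<le> real (card S)"
    and Q: "infsum d {i. U i \<inter> {u..v} \<noteq> {}} \<le> (v - u) / 384"
    and tail: "(\<Sum>\<^sub>\<infinity>i\<in>{i. d i < 1 / (6 * K)}. d i powr s) < (1 / 384) powr s * (v - u) / 32"
  shows "\<exists>p\<in>S. infsum d {i. U i \<inter> {p..p + r} \<noteq> {}} \<le> r / 384"
proof (rule ccontr)
  assume bad: "\<not> ?thesis"
  note [simp] = summable_on_subset_banach[OF sd subset_UNIV]
    summable_on_subset_banach[OF sds subset_UNIV]
  \<comment> \<open>Half the separation of \<open>S\<close>, and at least \<open>r\<close>. It
    divides large members from small ones.\<close>
  define g where "g = 1 / (6 * K)"
  have g: "0 < g" "1 / (3 * K) = 2 * g" unfolding g_def using K by auto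
  define hit where "hit p = {i. U i \<inter> {p..p + r} \<noteq> {}}" for p
  define B where "B = {i. U i \<inter> {u..v} \<noteq> {} \<and> g \<le> d i}"
  define R where "R i = {p \<in> S. i \<in> hit p}" for i
  have close: "\<bar>p - q\<bar> \<le> d i + r" if "i \<in> hit p" "i \<in> hit q" for i p q
  proof -
    from that obtain x y where x: "x \<in> U i" "x \<in> {p..p + r}" and y: "y \<in> U i" "y \<in> {q..q + r}"
      unfolding hit_def by blast
    from diam[OF x(1) y(1)] x(2) y(2) show ?thesis unfolding atLeastAtMost_iff by linarith
  qed
  have finB: "finite B"
  proof (rule ccontr)
    assume "infinite B"
    moreover have "real (card F) * g \<le> infsum d UNIV" if "finite F" "F \<subseteq> B" for F
    proof -
      have "real (card F) * g = (\<Sum>i\<in>F. g)" by simp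
      also have "\<dots> \<le> sum d F" using that by (intro sum_mono) (auto simp: B_def)
      also have "\<dots> \<le> infsum d UNIV" using that d by (intro finite_sum_le_infsum) (auto intro: less_imp_le)
      finally show ?thesis .
    qed
    ultimately have all: "real n * g \<le> infsum d UNIV" for n
      by (metis infinite_arbitrarily_large)
    obtain n :: nat where "infsum d UNIV / g < real n" using reals_Archimedean2 by blast
    hence "infsum d UNIV < real n * g" using g by (simp add: field_simps)
    with all[of n] show False by simp
  qed
  \<comment> \<open>The points of \<open>R i\<close> span at most \<open>d i + r\<close> and are
    \<open>2 * g\<close> apart; for a large member both \<open>r\<close> and \<open>g\<close> are at
    most \<open>d i\<close>.\<close>
  have cardR: "real (card (R i)) \<le> 12 * K * d i" if "i \<in> B" for i
  proof -
    have "real (card (R i)) \<le> 1 + (d i + r) / (2 * g)"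
      using S(1,3) close d[of i] r(1) g by (intro card_separated_le) (auto simp: R_def)
    also have "\<dots> \<le> 2 * d i / g"
    proof -
      have "r \<le> d i" "g \<le> d i" using that r unfolding B_def g_def by auto
      have "(d i + r) / (2 * g) \<le> (d i + d i) / (2 * g)"
        using \<open>r \<le> d i\<close> g(1) by (intro divide_right_mono) auto
      moreover have "1 \<le> d i / g" using \<open>g \<le> d i\<close> g(1) by (simp only: pos_le_divide_eq mult_1)
      ultimately show ?thesis by simp
    qed
    also have "\<dots> = 12 * K * d i" unfolding g_def using K by simp
    finally show ?thesis .
  qed
  \<comment> \<open>The points whose intervals meet no large member; at least half of the guaranteed
    number survive.\<close>
  define S' where "S' = S - (\<Union>i\<in>B. R i)"
  have "real (card (\<Union>i\<in>B. R i)) \<le> real (\<Sum>i\<in>B. card (R i))"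
    using card_UN_le[OF finB] by (simp only: of_nat_le_iff)
  also have "\<dots> \<le> (\<Sum>i\<in>B. 12 * K * d i)" using cardR by (simp add: sum_mono)
  also have "\<dots> = 12 * K * sum d B" by (simp add: sum_distrib_left)
  also have "\<dots> \<le> 12 * K * ((v - u) / 384)"
  proof (rule mult_left_mono)
    have "sum d B \<le> infsum d {i. U i \<inter> {u..v} \<noteq> {}}"
      using finB d by (intro finite_sum_le_infsum) (auto simp: B_def intro: less_imp_le)
    thus "sum d B \<le> (v - u) / 384" using Q by simp
  qed (use K in simp)
  finally have "real (card (\<Union>i\<in>B. R i)) \<le> K * (v - u) / 32" by simp
  moreover have "card S - card (\<Union>i\<in>B. R i) \<le> card S'"
    unfolding S'_def by (rule diff_card_le_card_Diff) (use finB S(1) in \<open>auto simp: R_def\<close>)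
  hence "real (card S) - real (card (\<Union>i\<in>B. R i)) \<le> real (card S')" by linarith
  ultimately have cS': "K * (v - u) / 32 \<le> real (card S')" using S(4) by linarith
  have small: "d i < g" if "p \<in> S'" "i \<in> hit p" for p i
  proof (rule ccontr)
    assume "\<not> d i < g"
    moreover have "U i \<inter> {u..v} \<noteq> {}" using that S(2)[of p] unfolding S'_def hit_def by blast
    ultimately have "i \<in> B" by (simp add: B_def)
    with that show False by (auto simp: S'_def R_def)
  qed
  have cost: "(r / 384) powr s \<le> (\<Sum>\<^sub>\<infinity>i\<in>hit p. d i powr s)" if "p \<in> S'" for p
  proof (rule ccontr)
    assume "\<not> ?thesis"
    hence "(\<Sum>\<^sub>\<infinity>i\<in>hit p. d i powr s) \<le> (r / 384) powr s" by simp
    moreover have "0 < r / 384" using r(1) by simp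
    ultimately have "infsum d (hit p) \<le> r / 384"
      by (intro infsum_le_of_infsum_powr_le[OF s d]) simp_all
    with bad that show False unfolding S'_def hit_def by blast
  qed
  \<comment> \<open>Since \<open>r powr s = 1 / K\<close>, the factor \<open>K\<close> cancels and
    the lower bound does not depend on the level.\<close>
  have "(1 / 384) powr s * (v - u) / 32 = (K * (v - u) / 32) * (r / 384) powr s"
    using r(1) K by (simp add: powr_divide r(3))
  also have "\<dots> \<le> real (card S') * (r / 384) powr s" using cS' by (intro mult_right_mono) auto
  also have "\<dots> \<le> (\<Sum>p\<in>S'. \<Sum>\<^sub>\<infinity>i\<in>hit p. d i powr s)"
    using sum_mono[OF cost, of S'] by simp
  also have "\<dots> = (\<Sum>\<^sub>\<infinity>i\<in>(\<Union>p\<in>S'. hit p). d i powr s)"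
  proof (rule sum_infsum)
    show "finite S'" using S(1) by (simp add: S'_def)
    fix p q assume pq: "p \<in> S'" "q \<in> S'" "p \<noteq> q"
    \<comment> \<open>Points hit by a common small member would be less than
      \<open>g + r \<le> 2 * g\<close> apart. Thus no member is counted twice and the costs
      add.\<close>
    show "hit p \<inter> hit q = {}"
    proof (rule ccontr)
      assume "hit p \<inter> hit q \<noteq> {}"
      then obtain i where i: "i \<in> hit p" "i \<in> hit q" by blast
      have "2 * g \<le> \<bar>p - q\<bar>" using pq S(3) g by (auto simp: S'_def)
      with close[OF i] small[OF pq(1) i(1)] r(2) show False unfolding g_def by linarith
    qed
  qed simp
  also have "\<dots> \<le> (\<Sum>\<^sub>\<infinity>i\<in>{i. d i < 1 / (6 * K)}. d i powr s)"
    using small unfolding g_def by (intro infsum_mono2) auto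
  finally show False using tail by simp
qed

text \<open>As every \<open>d i\<close> is positive, each finite set of indices eventually leaves
  \<open>{i. d i < g k}\<close>; what remains is bounded by a tail of the convergent sum of
  \<open>f\<close>.\<close>

lemma infsum_small_terms_tendsto_0:
  fixes d f :: "nat \<Rightarrow> real" and g :: "nat \<Rightarrow> real"
  assumes d: "\<And>i. 0 < d i" and f: "\<And>i. 0 \<le> f i" "f summable_on UNIV"
    and g: "g \<longlonglongrightarrow> 0" and e: "0 < e"
  shows "\<forall>\<^sub>F k in sequentially. infsum f {i. d i < g k} < e"
proof -
  note [simp] = summable_on_subset_banach[OF f(2) subset_UNIV]
  have "f sums infsum f UNIV" using f by (simp add: has_sum_imp_sums)
  hence "(\<lambda>n. sum f {..<n}) \<longlonglongrightarrow> infsum f UNIV" by (simp add: sums_def)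
  hence "\<forall>\<^sub>F n in sequentially. infsum f UNIV - e < sum f {..<n}"
    using e by (intro order_tendstoD(1)) auto
  then obtain N where N: "infsum f UNIV - e < sum f {..<N}" by (auto simp: eventually_sequentially)
  have "\<forall>i\<in>{..<N}. \<forall>\<^sub>F k in sequentially. g k < d i"
    using g d by (auto intro: order_tendstoD(2))
  hence "\<forall>\<^sub>F k in sequentially. \<forall>i\<in>{..<N}. g k < d i" by (simp add: eventually_ball_finite)
  thus ?thesis
  proof eventually_elim
    case (elim k)
    have "sum f {..<N} + infsum f {i. d i < g k} = infsum f ({..<N} \<union> {i. d i < g k})"
      using elim by (subst infsum_Un_disjoint) (auto simp: disjoint_iff not_less intro: less_imp_le)
    also have "\<dots> \<le> infsum f UNIV" using f by (intro infsum_mono2) auto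
    finally show ?case using N by linarith
  qed
qed

section \<open>Nested intervals that avoid a cover\<close>

text \<open>The weight \<open>d i\<close> bounds the diameter of \<open>U i\<close>, and its
  positivity keeps the limit point out of \<open>U i\<close>. The bound \<open>1 / 768\<close> is
  \<open>(1 - 1/2) / 384\<close>, the invariant \<open>Q\<close> on the starting interval
  \<open>[1/2, 1]\<close>.\<close>

lemma W_sqrt2_not_covered:
  fixes U :: "nat \<Rightarrow> real set" and d :: "nat \<Rightarrow> real" and \<alpha> :: real
  defines "\<Psi> \<equiv> \<lambda>n. 2 powr (- (real n * \<alpha>))"
  assumes \<alpha>: "1 < \<alpha>" and d: "\<And>i. 0 < d i"
    and diam: "\<And>i x y. x \<in> U i \<Longrightarrow> y \<in> U i \<Longrightarrow> \<bar>x - y\<bar> \<le> d i"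
    and sd: "d summable_on UNIV" and sds: "(\<lambda>i. d i powr (1 / \<alpha>)) summable_on UNIV"
    and small: "infsum d UNIV \<le> 1 / 768"
  shows "\<exists>x\<in>W (sqrt 2) \<Psi>. \<forall>i. x \<notin> U i"
proof -
  note [simp] = summable_on_subset_banach[OF sd subset_UNIV]
  define Q where "Q u v \<longleftrightarrow> infsum d {i. U i \<inter> {u..v} \<noteq> {}} \<le> (v - u) / 384" for u v
  define q where "q = 2 powr (- (2 * \<alpha>))"
  have \<Psi>_pos: "0 < \<Psi> n" for n by (simp add: \<Psi>_def)
  have \<Psi>_q: "\<Psi> (2 * k) = q ^ k" for k
    by (simp add: \<Psi>_def q_def powr_realpow[symmetric] powr_powr mult_ac)
  \<comment> \<open>This uses \<open>\<alpha> > 1\<close>: intervals of level \<open>2 * k\<close>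
    become much shorter than the spacing, of order \<open>4 ^ (-k)\<close>.\<close>
  have q4: "4 * q < 1"
  proof -
    have "4 * q = 2 powr 2 * q" by simp
    also have "\<dots> = 2 powr (2 - 2 * \<alpha>)" unfolding q_def powr_add[symmetric] by simp
    also have "\<dots> < 1" using powr_less_mono[of "2 - 2 * \<alpha>" 0 2] \<alpha> by simp
    finally show ?thesis .
  qed
  have q: "0 < q" "q < 1" using q4 unfolding q_def by (auto simp: q_def)
  have step: "\<exists>n\<ge>m. \<exists>p\<in>beta_sums (sqrt 2) n. u \<le> p \<and> p + \<Psi> n \<le> v \<and> Q p (p + \<Psi> n)"
    if uv: "1/2 \<le> u" "u < v" "v \<le> 1" "Q u v" for u v m
  proof -
    \<comment> \<open>Demands on \<open>k\<close>: small members have little cost;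
      \<open>2 ^ k * (v - u) \<ge> 4\<close> for the counting; an interval of length
      \<open>q ^ k\<close> starting in the left half ends before \<open>v\<close>; and
      \<open>(4 * q) ^ k < 1 / 6\<close> makes it at most half the separation.\<close>
    have "(\<lambda>k. (1/6) * (1/4) ^ k) \<longlonglongrightarrow> (1/6) * (0::real)"
      by (intro tendsto_mult tendsto_const LIMSEQ_realpow_zero) auto
    hence "(\<lambda>k. 1 / (6 * 4 ^ k)) \<longlonglongrightarrow> (0::real)" by (simp add: power_one_over divide_simps)
    hence "\<forall>\<^sub>F k in sequentially. (\<Sum>\<^sub>\<infinity>i\<in>{i. d i < 1 / (6 * 4 ^ k)}. d i powr (1 / \<alpha>))
        < (1 / 384) powr (1 / \<alpha>) * (v - u) / 32"
      using uv d sds by (intro infsum_small_terms_tendsto_0) auto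
    moreover have "\<forall>\<^sub>F k in sequentially. (1/2) ^ k < (v - u) / 4"
      using uv by (intro order_tendstoD(2)[OF LIMSEQ_realpow_zero]) auto
    moreover have "\<forall>\<^sub>F k in sequentially. q ^ k < (v - u) / 2"
      using uv q by (intro order_tendstoD(2)[OF LIMSEQ_realpow_zero]) auto
    moreover have "\<forall>\<^sub>F k in sequentially. (4 * q) ^ k < 1 / 6"
      using q q4 by (intro order_tendstoD(2)[OF LIMSEQ_realpow_zero]) auto
    moreover have "\<forall>\<^sub>F k in sequentially. max 2 m \<le> k" by (rule eventually_ge_at_top)
    ultimately have "\<forall>\<^sub>F k in sequentially. max 2 m \<le> k \<and> (4 * q) ^ k < 1 / 6 \<and>
        q ^ k < (v - u) / 2 \<and> (1/2) ^ k < (v - u) / 4 \<and>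
        (\<Sum>\<^sub>\<infinity>i\<in>{i. d i < 1 / (6 * 4 ^ k)}. d i powr (1 / \<alpha>))
        < (1 / 384) powr (1 / \<alpha>) * (v - u) / 32"
      by eventually_elim simp
    then obtain k where k: "2 \<le> k" "m \<le> k" "(4 * q) ^ k < 1 / 6" "q ^ k < (v - u) / 2"
      "(1/2) ^ k < (v - u) / 4"
      and tail: "(\<Sum>\<^sub>\<infinity>i\<in>{i. d i < 1 / (6 * 4 ^ k)}. d i powr (1 / \<alpha>))
        < (1 / 384) powr (1 / \<alpha>) * (v - u) / 32"
      by (auto simp: eventually_sequentially)
    have "4 \<le> 2 ^ k * (v - u)" using k(5) by (simp add: power_one_over field_simps)
    from many_separated_beta_sums[OF uv(1,3,2) k(1) this]
    obtain S where S: "finite S" "S \<subseteq> beta_sums (sqrt 2) (2 * k)" "S \<subseteq> {u..(u + v) / 2}"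
      "\<forall>p\<in>S. \<forall>q\<in>S. p \<noteq> q \<longrightarrow> 1 / (3 * 4 ^ k) \<le> \<bar>p - q\<bar>"
      "4 ^ k * (v - u) / 16 \<le> real (card S)" by blast
    have r: "\<Psi> (2 * k) \<le> 1 / (6 * 4 ^ k)"
      using k(3) unfolding \<Psi>_q by (simp add: power_mult_distrib field_simps)
    \<comment> \<open>The exponent is critical: an interval of this level has \<open>s\<close>-cost
      exactly \<open>1 / 4 ^ k\<close>, while there are \<open>4 ^ k\<close> pairs
      \<open>(a, b)\<close>.\<close>
    have "\<Psi> (2 * k) powr (1 / \<alpha>) = 2 powr (- real (2 * k))"
      using \<alpha> by (simp add: \<Psi>_def powr_powr)
    also have "\<dots> = 1 / 2 ^ (2 * k)"
      by (simp only: powr_minus powr_realpow[OF zero_less_numeral]) (simp add: divide_simps)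
    also have "\<dots> = 1 / 4 ^ k" by (simp add: power_mult)
    finally have rs: "\<Psi> (2 * k) powr (1 / \<alpha>) = 1 / 4 ^ k" .
    have inside: "u \<le> p \<and> p + \<Psi> (2 * k) \<le> v" if "p \<in> S" for p
    proof -
      have "u \<le> p" "p \<le> (u + v) / 2" using that S(3) by auto
      thus ?thesis using k(4) unfolding \<Psi>_q by (simp add: field_simps)
    qed
    have "\<exists>p\<in>S. infsum d {i. U i \<inter> {p..p + \<Psi> (2 * k)} \<noteq> {}} \<le> \<Psi> (2 * k) / 384"
    proof (rule exists_good_subinterval[OF _ _ d diam sd sds _ \<Psi>_pos r rs uv(2) S(1) _ _ S(5) _ tail])
      show "infsum d {i. U i \<inter> {u..v} \<noteq> {}} \<le> (v - u) / 384" using uv(4) unfolding Q_def .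
    qed (use \<alpha> inside S(4) in auto)
    then obtain p where p: "p \<in> S" "Q p (p + \<Psi> (2 * k))" unfolding Q_def by auto
    show ?thesis
      using p inside[OF p(1)] S(2) k(2) by (intro exI[of _ "2 * k"] conjI bexI[of _ p]) auto
  qed
  \<comment> \<open>The interval with index \<open>j + 1\<close> has level at least
    \<open>j\<close>, so a common point lies in intervals of arbitrarily high level.\<close>
  have "\<exists>I. \<forall>j. (1/2 \<le> fst (I j) \<and> fst (I j) < snd (I j) \<and> snd (I j) \<le> 1 \<and> Q (fst (I j)) (snd (I j))) \<and>
     (\<exists>n\<ge>j. fst (I (Suc j)) \<in> beta_sums (sqrt 2) n \<and> snd (I (Suc j)) = fst (I (Suc j)) + \<Psi> n \<and>
       fst (I j) \<le> fst (I (Suc j)) \<and> snd (I (Suc j)) \<le> snd (I j))"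
  proof (rule dependent_nat_choice, goal_cases)
    case 1
    have "infsum d {i. U i \<inter> {1/2..1} \<noteq> {}} \<le> infsum d UNIV"
      using sd d by (intro infsum_mono2) (auto intro: less_imp_le)
    hence "Q (1/2) 1" using small unfolding Q_def by simp
    thus ?case by (intro exI[of _ "(1/2, 1)"]) simp
  next
    case (2 I j)
    then obtain n p where n: "j \<le> n" "p \<in> beta_sums (sqrt 2) n" "fst I \<le> p" "p + \<Psi> n \<le> snd I"
      "Q p (p + \<Psi> n)" using step[of "fst I" "snd I" j] by blast
    show ?case
      by (intro exI[of _ "(p, p + \<Psi> n)"]) (use n 2 \<Psi>_pos[of n] in auto)
  qed
  then obtain I where I: "\<And>j. fst (I j) < snd (I j)" "\<And>j. Q (fst (I j)) (snd (I j))"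
    and I': "\<And>j. \<exists>n\<ge>j. fst (I (Suc j)) \<in> beta_sums (sqrt 2) n \<and>
       snd (I (Suc j)) = fst (I (Suc j)) + \<Psi> n \<and>
       fst (I j) \<le> fst (I (Suc j)) \<and> snd (I (Suc j)) \<le> snd (I j)"
    by blast
  define F where "F j = {fst (I j)..snd (I j)}" for j
  have "F (Suc j) \<subseteq> F j" for j using I'[of j] by (auto simp: F_def)
  hence dec: "decseq F" by (rule decseq_SucI)
  have "\<Inter>(range F) \<noteq> {}"
  proof (rule compact_nest)
    show "F n \<noteq> {}" for n using I(1)[of n] by (simp add: F_def)
    show "m \<le> n \<Longrightarrow> F n \<subseteq> F m" for m n using dec by (rule decseqD)
  qed (simp add: F_def)
  then obtain x where x: "\<And>j. x \<in> F j" by blast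
  have "x \<in> W (sqrt 2) \<Psi>"
    unfolding W_eq
  proof (intro INT_I)
    fix m :: nat
    from I'[of m] obtain n where n: "m \<le> n" "fst (I (Suc m)) \<in> beta_sums (sqrt 2) n"
      "snd (I (Suc m)) = fst (I (Suc m)) + \<Psi> n" by blast
    show "x \<in> (\<Union>n\<in>{m..}. \<Union>p\<in>beta_sums (sqrt 2) n. {p..p + \<Psi> n})"
      using n x[of "Suc m"] unfolding F_def by auto
  qed
  \<comment> \<open>A member containing \<open>x\<close> meets every chosen interval, so
    \<open>Q\<close> bounds \<open>d i\<close> by lengths that tend to 0.\<close>
  moreover have "x \<notin> U i" for i
  proof
    assume xi: "x \<in> U i"
    have "(\<lambda>j. (2 powr (- \<alpha>)) ^ j) \<longlonglongrightarrow> 0"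
      using \<alpha> powr_less_mono[of "- \<alpha>" 0 2] by (intro LIMSEQ_realpow_zero) auto
    hence "\<forall>\<^sub>F j in sequentially. (2 powr (- \<alpha>)) ^ j < d i" using d by (intro order_tendstoD(2)) auto
    then obtain j where j: "(2 powr (- \<alpha>)) ^ j < d i" by (auto simp: eventually_sequentially)
    from I'[of j] obtain n where n: "j \<le> n" "snd (I (Suc j)) = fst (I (Suc j)) + \<Psi> n" by blast
    have "d i = sum d {i}" by simp
    also have "\<dots> \<le> infsum d {i. U i \<inter> {fst (I (Suc j))..snd (I (Suc j))} \<noteq> {}}"
      using xi x[of "Suc j"] d by (intro finite_sum_le_infsum) (auto simp: F_def intro: less_imp_le)
    also have "\<dots> \<le> \<Psi> n / 384" using I(2)[of "Suc j"] n unfolding Q_def by simp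
    also have "\<dots> \<le> \<Psi> n" using \<Psi>_pos[of n] by simp
    also have "\<dots> \<le> \<Psi> j" unfolding \<Psi>_def using n \<alpha> by (simp add: mult_right_mono)
    also have "\<dots> = (2 powr (- \<alpha>)) ^ j" by (simp add: \<Psi>_def powr_realpow[symmetric] powr_powr mult_ac)
    finally show False using j by simp
  qed
  ultimately show ?thesis by blast
qed

section \<open>Contradiction from a cover of finite cost\<close>

theorem theorem3p3:
  fixes \<alpha> :: real
  assumes "\<alpha> > 1"
  shows "hausdorff_measure (1 / \<alpha>) (W (sqrt 2) (\<lambda>n. 2 powr (- (real n * \<alpha>)))) = \<infinity>"
proof (rule ccontr)
  define s where "s = 1 / \<alpha>"
  have s: "0 < s" "s < 1" using assms by (auto simp: s_def)
  let ?W = "W (sqrt 2) (\<lambda>n. 2 powr (- (real n * \<alpha>)))"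
  assume "\<not> ?thesis"
  hence "hausdorff_measure s ?W < top" by (simp add: s_def less_top)
  then obtain K where K: "0 \<le> K" "hausdorff_measure s ?W = ennreal K"
    by (cases "hausdorff_measure s ?W") auto
  \<comment> \<open>Adding 1 gives a strict bound that is positive, as needed for the division in
    \<open>\<delta>\<close>, even if the measure is 0.\<close>
  define K' where "K' = K + 1"
  have K': "0 < K'" "hausdorff_measure s ?W < ennreal K'"
    using K unfolding K'_def by (auto simp: ennreal_lessI)
  \<comment> \<open>By \<open>D i \<le> \<delta> powr (1 - s) * D i powr s\<close>, this mesh makes
    the diameters sum to at most \<open>1 / 1536\<close>, half of the allowed
    \<open>1 / 768\<close>. The other half is left for \<open>e\<close>.\<close>
  define \<delta> where "\<delta> = (1 / (1536 * K')) powr (1 / (1 - s))"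
  have \<delta>: "0 < \<delta>" "\<delta> powr (1 - s) = 1 / (1536 * K')"
    using K' s by (auto simp: \<delta>_def powr_powr)
  have "hausdorff_premeasure s \<delta> ?W \<le> hausdorff_measure s ?W"
    unfolding hausdorff_measure_def using \<delta>(1) by (intro SUP_upper) auto
  hence "hausdorff_premeasure s \<delta> ?W < ennreal K'" using K' by simp
  then obtain U :: "nat \<Rightarrow> real set" where U: "?W \<subseteq> (\<Union>i. U i)" "\<And>i. bounded (U i)"
    "\<And>i. diameter (U i) \<le> \<delta>" "(\<Sum>i. diam_pow s (U i)) < ennreal K'"
    unfolding hausdorff_premeasure_def INF_less_iff by auto
  define D where "D i = diameter (U i)" for i
  have D: "0 \<le> D i" "D i \<le> \<delta>" for i
    using U by (auto simp: D_def diameter_ge_0)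
  \<comment> \<open>As \<open>s > 0\<close>, the empty set, of diameter 0, also fits the plain
    power.\<close>
  have "diam_pow s (U i) = ennreal (D i powr s)" for i
    using s by (simp add: diam_pow_def D_def)
  with U(4) have lt: "(\<Sum>i. ennreal (D i powr s)) < ennreal K'" by simp
  have smDs: "summable (\<lambda>i. D i powr s)"
    using lt by (intro summable_suminf_not_top) auto
  have "ennreal (\<Sum>i. D i powr s) < ennreal K'"
    using lt smDs by (subst suminf_ennreal2[symmetric]) auto
  hence sumDs: "(\<Sum>i. D i powr s) \<le> K'" using K' by (simp add: ennreal_less_iff suminf_nonneg smDs)
  have Dle: "D i \<le> \<delta> powr (1 - s) * D i powr s" for i
  proof (cases "D i = 0")
    case False
    hence "D i = D i powr (1 - s) * D i powr s" using D[of i] by (simp add: powr_add[symmetric])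
    also have "\<dots> \<le> \<delta> powr (1 - s) * D i powr s"
      using D[of i] s by (intro mult_right_mono powr_mono2) auto
    finally show ?thesis .
  qed simp
  have smD: "summable D"
    using D by (intro summable_comparison_test'[OF summable_mult[OF smDs], where N = 0]) (auto intro: Dle)
  have "suminf D \<le> (\<Sum>i. \<delta> powr (1 - s) * D i powr s)"
    by (intro suminf_le Dle smD summable_mult smDs)
  also have "\<dots> = \<delta> powr (1 - s) * (\<Sum>i. D i powr s)" by (intro suminf_mult smDs)
  also have "\<dots> \<le> 1 / (1536 * K') * K'" unfolding \<delta>(2) using K' sumDs by (intro mult_left_mono) auto
  finally have sumD: "suminf D \<le> 1 / 1536" using K' by simp
  text \<open>Singletons have diameter 0, hence the positive lower bound on the weights.\<close>
  define e :: "nat \<Rightarrow> real" where "e i = 1 / 3072 * (1 / 2) ^ i" for i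
  have e: "0 < e i" for i by (simp add: e_def)
  have "e sums (1 / 3072 * (1 / (1 - 1 / 2)))"
    unfolding e_def by (intro sums_mult geometric_sums) simp
  hence sme: "summable e" "suminf e = 1 / 1536" by (auto simp: sums_iff)
  have pow_powr: "(x ^ i) powr s = (x powr s) ^ i" for x :: real and i
    by (induction i) (simp_all add: powr_mult)
  \<comment> \<open>The powers again form a geometric sequence, now with ratio
    \<open>(1 / 2) powr s\<close>.\<close>
  have "e i powr s = (1 / 3072) powr s * ((1 / 2) powr s) ^ i" for i
    unfolding e_def powr_mult pow_powr ..
  moreover have "(1 / 2) powr s < 1" using powr_less_mono2[of s "1/2" 1] s by simp
  ultimately have smes: "summable (\<lambda>i. e i powr s)"
    by (auto intro!: summable_mult summable_geometric)
  \<comment> \<open>The maximum still bounds the diameter, is positive, and is at most the sum, so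
    both series stay summable.\<close>
  define d where "d i = max (D i) (e i)" for i
  have d: "0 < d i" "d i \<le> D i + e i" "d i powr s \<le> D i powr s + e i powr s" for i
    using e[of i] D[of i] by (auto simp: d_def max_def)
  have smd: "summable d"
    using d(1,2) by (intro summable_comparison_test'[OF summable_add[OF smD sme(1)], where N = 0])
      (auto simp: abs_of_pos)
  have smds: "summable (\<lambda>i. d i powr s)"
    using d(3) by (intro summable_comparison_test'[OF summable_add[OF smDs smes], where N = 0]) auto
  have sd: "d summable_on UNIV"
    using smd d(1) by (intro norm_summable_imp_summable_on) (simp add: abs_of_pos)
  have "infsum d UNIV = suminf d"
    using has_sum_imp_sums[OF has_sum_infsum[OF sd]] by (rule sums_unique)
  also have "\<dots> \<le> (\<Sum>i. D i + e i)"
    by (intro suminf_le d(2) smd summable_add smD sme)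
  also have "\<dots> = suminf D + suminf e" using smD sme by (intro suminf_add[symmetric])
  also have "\<dots> \<le> 1 / 768" using sumD sme(2) by simp
  finally have "infsum d UNIV \<le> 1 / 768" .
  moreover have "\<bar>x - y\<bar> \<le> d i" if "x \<in> U i" "y \<in> U i" for x y i
    using diameter_bounded_bound[OF U(2) that] by (simp add: d_def D_def dist_real_def max_def)
  moreover have "(\<lambda>i. d i powr s) summable_on UNIV"
    using smds by (intro norm_summable_imp_summable_on) simp
  ultimately obtain x where "x \<in> ?W" "\<And>i. x \<notin> U i"
    using W_sqrt2_not_covered[of \<alpha> d U] assms d(1) sd unfolding s_def by blast
  thus False using U(1) by blast
qed

end
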